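(* Let $D=(V,A)$ be a strongly connected tournament with $|V|\ge 2$. Then $|L(D)|\ge |V|$ or $V\in L(D)$; that is, $D$ has at least $|V|$ distinct lines or it has a universal line.
   Context: All digraphs are finite. A tournament is an orientation of a complete graph. A dipath is a directed path. For vertices $x,y$ of a digraph $D=(V,A)$, $[x,y]$ denotes the set of all vertices $z$ such that some shortest dipath from $x$ to $y$ contains $z$. For an ordered pair of distinct vertices $(x,y)$, the line it defines is $\overrightarrow{xy}=\{z\in V : x\in[z,y] \text{ or } y\in[x,z] \text{ or } z\in[x,y]\}$. $L(D)$ denotes the set of all lines $\overrightarrow{xy}$ over ordered pairs of distinct vertices $x,y$ of $D$ (as a set of subsets of $V$, so equal lines are counted once). A line is universal if it equals $V$. *)

theory Defs
  imports "Graph_Theory.Graph_Theory"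
begin

locale tournament = digraph +
  assumes orientation:
    "\<lbrakk>u \<in> verts G; v \<in> verts G; u \<noteq> v\<rbrakk> \<Longrightarrow> (u \<rightarrow>\<^bsub>G\<^esub> v) \<longleftrightarrow> \<not> (v \<rightarrow>\<^bsub>G\<^esub> u)"

definition shortest_dipath :: "('a, 'b) pre_digraph \<Rightarrow> 'a \<Rightarrow> 'b awalk \<Rightarrow> 'a \<Rightarrow> bool" where
  "shortest_dipath G x p y \<longleftrightarrow>
     pre_digraph.apath G x p y \<and>
     (\<forall>q. pre_digraph.apath G x q y \<longrightarrow> length p \<le> length q)"

definition interval :: "('a, 'b) pre_digraph \<Rightarrow> 'a \<Rightarrow> 'a \<Rightarrow> 'a set" where
  "interval G x y =
     {z. \<exists>p. shortest_dipath G x p y \<and> z \<in> set (pre_digraph.awalk_verts G x p)}"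

definition line :: "('a, 'b) pre_digraph \<Rightarrow> 'a \<Rightarrow> 'a \<Rightarrow> 'a set" where
  "line G x y =
     {z \<in> verts G. x \<in> interval G z y \<or> y \<in> interval G x z \<or> z \<in> interval G x y}"

definition lines :: "('a, 'b) pre_digraph \<Rightarrow> 'a set set" where
  "lines G = {line G x y | x y. x \<in> verts G \<and> y \<in> verts G \<and> x \<noteq> y}"

end

theory Submission
  imports Defs
begin

text \<open>
  Only lines of arcs are needed. For an arc \<open>x \<rightarrow> y\<close>, a vertex \<open>w\<close> is on the line iff
  \<open>d w y = d w x + 1\<close> or \<open>d x w = d y w + 1\<close>: nothing lies strictly between \<open>x\<close> and \<open>y\<close>.
  If no line of an arc is universal, then there are at least \<open>n = |V|\<close> of them, by a double
  count: the \<open>n(n - 1)/2\<close> arcs are partitioned into classes of arcs generating the same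
  line, and a class has, with few exceptions, at most \<open>(n - 1)/2\<close> arcs.

  Two arcs in a class share neither tail nor head (\<open>gen_same_tail\<close>, \<open>gen_same_head\<close>), so a class
  is a disjoint union of directed paths and cycles. If \<open>E\<close> is the set of ends of its arcs and
  \<open>I\<close> the set of inner vertices, which are both a head and a tail, then the class has
  \<open>(|E| + |I|)/2\<close> arcs. Three facts bound this number.

  First, \<open>|E| \<le> n - 2\<close> (\<open>uncovered_vertex\<close>). A vertex \<open>w\<close> off the line is not in \<open>E\<close>; if it
  were the only such vertex, the first step of a geodesic from \<open>w\<close> would end on an arc of the
  class, and this contradicts the way in which two arcs of a class lie relative to each other:
  disjoint ones lie on a common geodesic (\<open>gen_disjoint\<close>), consecutive ones span a directed
  triangle (\<open>gen_consecutive\<close>).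

  Secondly, two inner vertices force three consecutive arcs (\<open>disjoint_paths\<close>). The
  reason is that traversing an arc of the class is never progress towards a vertex \<open>w\<close> off the
  line, and never takes one away from \<open>w\<close> (\<open>gen_nonmem\<close>). So a suitable \<open>w\<close> near one path of two
  arcs (\<open>near\<close>, \<open>source_near\<close>) provides a shortcut between two such paths, which their
  relative position does not allow.

  Thirdly, three consecutive arcs in a class are the whole class (\<open>triangle_class\<close>,
  \<open>path_isolated\<close>). If they form a path, then there are \<open>q\<close> and \<open>r\<close> off the line such that
  all path vertices dominate \<open>q\<close>, which dominates \<open>r\<close>, which dominates all path vertices
  (\<open>path_bottleneck\<close>); the line of \<open>q \<rightarrow> r\<close> contains these six vertices but is not universal, so that
  \<open>n \<ge> 7\<close>.

  Hence a class with more than \<open>(n - 1)/2\<close> arcs is a directed triangle and \<open>n \<le> 6\<close>. Such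
  triangles are pairwise disjoint (\<open>triangle_classes_disjoint\<close>), hence so few that the count
  still gives \<open>n\<close> lines (\<open>many_lines\<close>).
\<close>

section \<open>Distances in tournaments and arcs with a common line\<close>

(* Lets the SMT solvers treat the distances, which are natural numbers, arithmetically. *)
declare [[smt_nat_as_int]]

text \<open>The properties of the distance of a strong tournament on which the argument rests. They
  are invariant under reversing all arcs, which halves the case analyses below.\<close>
locale tournament_distance =
  fixes V :: "'a set" and d :: "'a \<Rightarrow> 'a \<Rightarrow> nat"
  assumes finite_V: "finite V"
    and dist_zero: "x \<in> V \<Longrightarrow> y \<in> V \<Longrightarrow> d x y = 0 \<longleftrightarrow> x = y"
    and triangle: "x \<in> V \<Longrightarrow> y \<in> V \<Longrightarrow> z \<in> V \<Longrightarrow> d x z \<le> d x y + d y z"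
    and orient: "x \<in> V \<Longrightarrow> y \<in> V \<Longrightarrow> x \<noteq> y \<Longrightarrow> d x y = 1 \<longleftrightarrow> d y x \<noteq> 1"
    and first_step: "x \<in> V \<Longrightarrow> y \<in> V \<Longrightarrow> d x y = Suc k \<Longrightarrow> \<exists>z\<in>V. d x z = 1 \<and> d z y = k"
    and last_step: "x \<in> V \<Longrightarrow> y \<in> V \<Longrightarrow> d x y = Suc k \<Longrightarrow> \<exists>z\<in>V. d x z = k \<and> d z y = 1"
begin

definition arc_line :: "'a \<Rightarrow> 'a \<Rightarrow> 'a set" where
  "arc_line x y = {w \<in> V. d w y = d w x + 1 \<or> d x w = d y w + 1}"

text \<open>All triangle inequalities and orientations within a small set of vertices, to be expanded
  by the simplifier into ground facts for a decision procedure.\<close>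
lemma local_facts:
  "S \<subseteq> V \<Longrightarrow> (\<forall>p\<in>S. \<forall>q\<in>S. \<forall>r\<in>S. d p r \<le> d p q + d q r) \<and>
    (\<forall>p\<in>S. \<forall>q\<in>S. p \<noteq> q \<longrightarrow> d p q \<noteq> 0 \<and> (d p q = 1 \<longleftrightarrow> d q p \<noteq> 1)) \<and> (\<forall>p\<in>S. d p p = 0)"
  using orient by (intro conjI ballI impI) (metis subsetD triangle dist_zero)+

lemma reverse: "tournament_distance V (\<lambda>x y. d y x)"
proof
  show "finite V" by (rule finite_V)
  fix x y z k assume V: "x \<in> V" "y \<in> V"
  show "d y x = 0 \<longleftrightarrow> x = y" using dist_zero[of y x] V by auto
  show "z \<in> V \<Longrightarrow> d z x \<le> d y x + d z y" using triangle[of z y x] V by simp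
  show "x \<noteq> y \<Longrightarrow> d y x = 1 \<longleftrightarrow> d x y \<noteq> 1" using orient[of y x] V by blast
  show "d y x = Suc k \<Longrightarrow> \<exists>z\<in>V. d z x = 1 \<and> d y z = k" using last_step[of y x k] V by blast
  show "d y x = Suc k \<Longrightarrow> \<exists>z\<in>V. d z x = k \<and> d y z = 1" using first_step[of y x k] V by blast
qed

text \<open>The arc from \<open>x\<close> to \<open>y\<close> generates \<open>l\<close>. For a fixed \<open>l\<close> this relation is the class of
  arcs with line \<open>l\<close>.\<close>
definition gen :: "'a set \<Rightarrow> 'a \<Rightarrow> 'a \<Rightarrow> bool" where
  "gen l x y \<longleftrightarrow> x \<in> V \<and> y \<in> V \<and> d x y = 1 \<and> arc_line x y = l"

lemma gen_V: "gen l x y \<Longrightarrow> x \<in> V" "gen l x y \<Longrightarrow> y \<in> V"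
  and gen_dist: "gen l x y \<Longrightarrow> d x y = 1"
  by (auto simp: gen_def)

lemma gen_mem:
  "gen l x y \<Longrightarrow> w \<in> V \<Longrightarrow> w \<in> l \<longleftrightarrow> d w y = d w x + 1 \<or> d x w = d y w + 1"
  by (auto simp: gen_def arc_line_def)

lemma gen_reverse: "tournament_distance.gen V (\<lambda>x y. d y x) l x y \<longleftrightarrow> gen l y x"
proof -
  interpret rev: tournament_distance V "\<lambda>x y. d y x"
    by (rule reverse)
  show ?thesis
    by (auto simp: gen_def rev.gen_def arc_line_def rev.arc_line_def)
qed

lemma gen_ends_mem: "gen l x y \<Longrightarrow> x \<in> l" "gen l x y \<Longrightarrow> y \<in> l"
  using gen_mem[of l x y x] gen_mem[of l x y y] gen_V[of l x y] gen_dist[of l x y] dist_zero[of x x] dist_zero[of y y] by simp_all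

lemma gen_distinct: "gen l x y \<Longrightarrow> x \<noteq> y"
  using gen_V[of l x y] gen_dist[of l x y] dist_zero[of x x] by auto

text \<open>If \<open>x \<rightarrow> y\<close> and \<open>x \<rightarrow> z\<close>, then \<open>z\<close> is on the line of \<open>x \<rightarrow> y\<close> only if \<open>y \<rightarrow> z\<close>; by symmetry a
  common line would need \<open>z \<rightarrow> y\<close> as well.\<close>
lemma gen_same_tail:
  assumes xy: "gen l x y" and xz: "gen l x z" shows "y = z"
proof (rule ccontr)
  assume ne: "y \<noteq> z"
  have V: "x \<in> V" "y \<in> V" "z \<in> V" using gen_V[OF xy] gen_V[OF xz] by simp_all
  have "d y z \<noteq> 0" "d z y \<noteq> 0" "d y z = 1 \<longleftrightarrow> d z y \<noteq> 1"
    using V ne dist_zero[of y z] dist_zero[of z y] orient[of y z] by blast+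
  moreover have "d z y = d z x + 1 \<or> d x z = d y z + 1" "d y z = d y x + 1 \<or> d x y = d z y + 1"
    using gen_mem[OF xy V(3)] gen_mem[OF xz V(2)] gen_ends_mem[OF xy] gen_ends_mem[OF xz] by blast+
  moreover have "d y x \<noteq> 0" "d z x \<noteq> 0" using V dist_zero[of y x] dist_zero[of z x] gen_distinct[OF xy] gen_distinct[OF xz] by blast+
  ultimately show False using gen_dist[OF xy] gen_dist[OF xz] by (smt (z3))
qed

lemma gen_same_head:
  assumes "gen l y x" "gen l z x" shows "y = z"
proof -
  interpret rev: tournament_distance V "\<lambda>x y. d y x"
    by (rule reverse)
  show ?thesis using rev.gen_same_tail[of l x y z] assms by (simp add: gen_reverse)
qed

text \<open>Comparing the directions of the four arcs between \<open>{x, y}\<close> and \<open>{u, v}\<close>, only two kinds of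
  position survive: a geodesic traverses first \<open>u \<rightarrow> v\<close> and then \<open>x \<rightarrow> y\<close>, or conversely. In what
  follows, ``\<open>u \<rightarrow> v\<close> precedes \<open>x \<rightarrow> y\<close>'' means the first alternative.\<close>
lemma gen_disjoint:
  assumes xy: "gen l x y" and uv: "gen l u v" and ne: "x \<noteq> u" "x \<noteq> v" "y \<noteq> u" "y \<noteq> v"
  shows "d u y = d v x + 2 \<or> d x v = d y u + 2"
proof -
  have V: "{x, y, u, v} \<subseteq> V" using gen_V[OF xy] gen_V[OF uv] by simp
  have F: "d u y = d u x + 1 \<or> d x u = d y u + 1" "d v y = d v x + 1 \<or> d x v = d y v + 1"
    "d x v = d x u + 1 \<or> d u x = d v x + 1" "d y v = d y u + 1 \<or> d u y = d v y + 1"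
    using gen_mem[OF xy, of u] gen_mem[OF xy, of v] gen_mem[OF uv, of x] gen_mem[OF uv, of y]
      gen_ends_mem[OF xy] gen_ends_mem[OF uv] gen_V[OF xy] gen_V[OF uv] by blast+
  note facts = local_facts[OF V, simplified] gen_distinct[OF xy] gen_distinct[OF uv] ne
    gen_dist[OF xy] gen_dist[OF uv] F
  show ?thesis using facts by (smt (z3))
qed

text \<open>The form in which vertices off the line are used: an arc of the class is no progress on the
  way to \<open>w\<close>, and its head is no farther from \<open>w\<close> than its tail.\<close>
lemma gen_nonmem:
  assumes "gen l x y" "w \<in> V" "w \<notin> l" shows "d x w \<le> d y w" "d w y \<le> d w x"
proof -
  have V: "{x, y, w} \<subseteq> V" using gen_V[OF assms(1)] assms(2) by simp
  show "d x w \<le> d y w" "d w y \<le> d w x"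
    using local_facts[OF V, simplified] gen_mem[OF assms(1,2)] assms(3) gen_dist[OF assms(1)]
    by (smt (z3))+
qed

text \<open>Otherwise \<open>x \<rightarrow> z\<close>, and the first vertex \<open>w\<close> after \<open>z\<close> on a geodesic from \<open>z\<close> to \<open>x\<close> would be
  on the line of \<open>x \<rightarrow> y\<close> but not on that of \<open>y \<rightarrow> z\<close>.\<close>
lemma gen_consecutive:
  assumes xy: "gen l x y" and yz: "gen l y z" shows "d z x = 1"
proof (rule ccontr)
  assume neg: "d z x \<noteq> 1"
  have V: "x \<in> V" "y \<in> V" "z \<in> V" using gen_V[OF xy] gen_V[OF yz] by simp_all
  have "d y x \<noteq> 1" using orient[of x y] V gen_distinct[OF xy] gen_dist[OF xy] by blast
  then have ne: "x \<noteq> z" using gen_dist[OF yz] by blast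
  then obtain k where "d z x = Suc k" using dist_zero[of z x] V by (cases "d z x") auto
  then obtain w where w: "w \<in> V" "d z w = 1" "d w x = k" using first_step V by blast
  have "{x, y, z, w} \<subseteq> V" using V w by simp
  note local_facts[OF this, simplified]
  then show False
    using neg ne w(2,3) gen_distinct[OF xy] gen_distinct[OF yz] gen_dist[OF xy] gen_dist[OF yz]
      gen_mem[OF xy V(3)] gen_ends_mem[OF yz] gen_mem[OF xy w(1)] gen_mem[OF yz w(1)] \<open>d z x = Suc k\<close>
    by (smt (z3))
qed

text \<open>Relative to two consecutive arcs of the class, a vertex on the line cannot be aligned with
  one arc from the front and with the other from the back: it extends the whole path to a
  geodesic, either before \<open>x\<close> or after \<open>z\<close>.\<close>
lemma gen_through:
  assumes xy: "gen l x y" and yz: "gen l y z" and w: "w \<in> l" "w \<in> V" "w \<noteq> x" "w \<noteq> y" "w \<noteq> z"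
  shows "d w y = d w x + 1 \<and> d w z = d w x + 2 \<or> d y w = d z w + 1 \<and> d x w = d z w + 2"
proof -
  have V: "{x, y, z, w} \<subseteq> V" using gen_V[OF xy] gen_V[OF yz] w by simp
  show ?thesis
    using local_facts[OF V, simplified] w(1,3-) gen_distinct[OF xy] gen_distinct[OF yz] gen_dist[OF xy] gen_dist[OF yz]
      gen_consecutive[OF xy yz] gen_mem[OF xy w(2)] gen_mem[OF yz w(2)]
    by (smt (z3))
qed

text \<open>A further vertex would be before or after each of the three pairs of consecutive arcs, so
  two pairs would agree, say in before; but then its distance would increase around the
  triangle.\<close>
lemma triangle_line:
  assumes xy: "gen l x y" and yz: "gen l y z" and zx: "gen l z x" 
  shows "l = {x, y, z}"
proof
  show "{x, y, z} \<subseteq> l" using gen_ends_mem[OF xy] gen_ends_mem[OF yz] by simp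
  show "l \<subseteq> {x, y, z}"
  proof (rule ccontr)
    assume "\<not> l \<subseteq> {x, y, z}"
    then obtain w where w: "w \<in> l" "w \<noteq> x" "w \<noteq> y" "w \<noteq> z" by blast
    then have "w \<in> V" using xy by (auto simp: gen_def arc_line_def)
    then show False
      using gen_through[OF xy yz w(1) _ w(2,3,4)] gen_through[OF yz zx w(1) _ w(3,4,2)] gen_through[OF zx xy w(1) _ w(4,2,3)] 
      by (smt (z3))
  qed
qed

section \<open>The arcs of a class miss two vertices\<close>

text \<open>A geodesic from \<open>w\<close> to \<open>v\<close> does not pass \<open>u\<close>, as \<open>w\<close> is off the line. If its first vertex
  \<open>p\<close> were on an arc of the class, the position of that arc relative to \<open>u \<rightarrow> v\<close> would either bring
  \<open>u\<close> closer to \<open>w\<close> than \<open>v\<close>, or give a geodesic of length three with the shortcut through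
  \<open>w\<close>.\<close>
lemma sink_escape:
  assumes uv: "gen l u v" and w: "w \<in> V" "w \<notin> l" "d u w = 1" "d v w = 1"
    and cover: "\<And>p. p \<in> V \<Longrightarrow> p \<noteq> w \<Longrightarrow> \<exists>q. gen l p q \<or> gen l q p"
  shows False
proof -
  have V: "u \<in> V" "v \<in> V" using gen_V[OF uv] by simp_all
  have wv: "w \<noteq> u" "w \<noteq> v" using gen_ends_mem[OF uv] w(2) by auto
  then obtain k where k: "d w v = Suc k" using dist_zero[of w v] V w(1) by (cases "d w v") auto
  then obtain p where p: "p \<in> V" "d w p = 1" "d p v = k" using first_step V w by blast
  have "p \<noteq> w" using p w(1) dist_zero[of w w] by auto
  then obtain a b where ab: "gen l a b" "p = a \<or> p = b" using cover[OF p(1)] by blast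
  have abV: "a \<in> V" "b \<in> V" using gen_V[OF ab(1)] by simp_all
  have S: "{u, v, w, a, b} \<subseteq> V" using V w abV by simp
  note facts = local_facts[OF S, simplified] gen_distinct[OF uv] gen_distinct[OF ab(1)] gen_dist[OF uv]
    gen_dist[OF ab(1)] wv w(2-4) gen_nonmem[OF uv w(1,2)] ab(2) p(2,3) k \<open>p \<noteq> w\<close>
  show False
  proof (cases "a = v \<or> b = u \<or> a = u \<or> b = v")
    case True
    then show False
      using facts gen_consecutive[OF uv, of b] gen_consecutive[of l a u v] 
        gen_same_tail[of l u v b] gen_same_head[of l u v a] uv ab(1) by (smt (z3))
  next
    case False
    then show False using facts gen_disjoint[OF uv ab(1)] by (smt (z3))
  qed
qed

text \<open>If every vertex but \<open>w\<close> were an end of an arc of the class, then by \<open>sink_escape\<close> and its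
  mirror image each of these arcs would have its tail dominate \<open>w\<close> and its head dominated by
  \<open>w\<close>. This allows only one arc, and three vertices which do not form a strong tournament.\<close>
lemma uncovered_vertex:
  assumes uv: "gen l u v" and w: "w \<in> V" "w \<notin> l"
  shows "\<exists>p\<in>V. p \<noteq> w \<and> (\<forall>q. \<not> gen l p q \<and> \<not> gen l q p)"
proof (rule ccontr)
  assume "\<not> ?thesis"
  then have cover: "\<exists>q. gen l p q \<or> gen l q p" if "p \<in> V" "p \<noteq> w" for p using that by blast
  interpret rev: tournament_distance V "\<lambda>x y. d y x" by (rule reverse)
  have through: "d a w = 1 \<and> d w b = 1" if ab: "gen l a b" for a b
  proof -
    have V: "{a, b, w} \<subseteq> V" using gen_V[OF ab] w by simp
    have "w \<noteq> a" "w \<noteq> b" using gen_ends_mem[OF ab] w(2) by auto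
    moreover have "\<not> (d a w = 1 \<and> d b w = 1)" using sink_escape[OF ab w] cover by blast
    moreover have "\<not> (d w b = 1 \<and> d w a = 1)"
      using rev.sink_escape[of l b a w] cover w ab by (auto simp: gen_reverse)
    ultimately show ?thesis
      using local_facts[OF V, simplified] gen_nonmem[OF ab w] by (smt (z3))
  qed
  have only: "a = u \<and> b = v" if ab: "gen l a b" for a b
  proof (rule ccontr)
    assume ne: "\<not> (a = u \<and> b = v)"
    then have "a \<noteq> u" "b \<noteq> v" using gen_same_tail[of l u v b] gen_same_head[of l u v a] ab uv by blast+
    moreover have "b \<noteq> u" "a \<noteq> v" using through[OF ab] through[OF uv] orient[of w u] orient[of w v] 
       gen_ends_mem[OF uv] w gen_V[OF uv] by metis+
    ultimately have "d u b = d v a + 2 \<or> d a v = d b u + 2" using gen_disjoint[OF ab uv] by blast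
    moreover have "d u b \<le> 2" "d a v \<le> 2"
      using through[OF ab] through[OF uv] triangle[of u w b] triangle[of a w v] gen_V[OF uv] gen_V[OF ab] w by (smt (z3))+
    moreover have "d v a \<noteq> 0" "d b u \<noteq> 0"
      using dist_zero[of v a] dist_zero[of b u]  gen_V[OF uv] gen_V[OF ab] \<open>b \<noteq> u\<close> \<open>a \<noteq> v\<close> by blast+
    ultimately show False by linarith
  qed
  have V: "p = u \<or> p = v \<or> p = w" if "p \<in> V" for p using cover[OF that] only by blast
  have uvV: "u \<in> V" "v \<in> V" "u \<noteq> v" using gen_V[OF uv] gen_distinct[OF uv] by auto
  then obtain k where "d v u = Suc k" using dist_zero[of v u] by (cases "d v u") auto
  then obtain z where "z \<in> V" "d v z = 1" using first_step[OF uvV(2,1)] by blast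
  then show False
    using V[of z] uvV orient[of u v] gen_dist[OF uv] through[OF uv] orient[of v w] gen_ends_mem[OF uv] w dist_zero[of v v]
    by (metis zero_neq_one)
qed

section \<open>Vertices off the line near consecutive arcs\<close>

text \<open>If \<open>d x w\<close> is at least three, the last vertex before \<open>w\<close> on a geodesic from \<open>x\<close> to \<open>w\<close> is
  also off the line and dominates the path, and it is closer to \<open>x\<close>.\<close>
lemma source_near:
  assumes xy: "gen l x y" and yz: "gen l y z" and w: "w \<in> V" "w \<notin> l" "d w x = 1"
  shows "\<exists>w'\<in>V. w' \<notin> l \<and> d w' x = 1 \<and> d w' y = 1 \<and> d w' z = 1 \<and> d x w' = 2"
  using w
proof (induction "d x w" arbitrary: w rule: less_induct)
  case less
  note w = less.prems
  have V: "x \<in> V" "y \<in> V" "z \<in> V" using gen_V[OF xy] gen_V[OF yz] by simp_all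
  have ne: "w \<noteq> x" "w \<noteq> y" "w \<noteq> z" using gen_ends_mem[OF xy] gen_ends_mem[OF yz] w by auto
  note non = gen_nonmem[OF xy w(1,2)] gen_nonmem[OF yz w(1,2)]
  have one: "d w y = 1" "d w z = 1"
    using non w(3) dist_zero[of w y] dist_zero[of w z] V w(1) ne by linarith+
  have ge2: "d x w \<noteq> 0" "d x w \<noteq> 1" using orient[of x w] dist_zero[of x w] V w ne by blast+
  show ?case
  proof (cases "d x w = 2")
    case True
    then show ?thesis using w one by blast
  next
    case False
    obtain k where k: "d x w = Suc k" using ge2 by (cases "d x w") auto
    then obtain r where r: "r \<in> V" "d x r = k" "d r w = 1" using last_step V w by blast
    have S: "{x, y, z, w, r} \<subseteq> V" using V w r by simp
    note facts = local_facts[OF S, simplified] one w(3) k r(2,3) False ge2 ne non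
      gen_dist[OF xy] gen_dist[OF yz] gen_distinct[OF xy] gen_distinct[OF yz] 
    have "r \<noteq> x \<and> r \<noteq> y \<and> r \<noteq> z \<and> d r x = 1" using facts by (smt (z3))
    moreover from this have "r \<notin> l" using gen_through[OF xy yz _ r(1)] facts by (smt (z3))
    ultimately show ?thesis using less.hyps[of r] r k lessI by metis
  qed
qed

lemma sink_near:
  assumes xy: "gen l x y" and yz: "gen l y z" and w: "w \<in> V" "w \<notin> l" "d z w = 1"
  shows "\<exists>w'\<in>V. w' \<notin> l \<and> d x w' = 1 \<and> d y w' = 1 \<and> d z w' = 1 \<and> d w' z = 2"
proof -
  interpret rev: tournament_distance V "\<lambda>x y. d y x" by (rule reverse)
  show ?thesis
    using rev.source_near[of l z y x w, unfolded gen_reverse, OF yz xy w] by blast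
qed

text \<open>A vertex off the line that has neither the orientation of \<open>source_near\<close> nor that of
  \<open>sink_near\<close> is itself a midpoint between \<open>x\<close> and \<open>z\<close>.\<close>
lemma near:
  assumes xy: "gen l x y" and yz: "gen l y z" and w: "w \<in> V" "w \<notin> l"
  shows "\<exists>w'\<in>V. w' \<notin> l \<and> d x w' + d w' z \<le> 3"
proof -
  have V: "x \<in> V" "y \<in> V" "z \<in> V" using gen_V[OF xy] gen_V[OF yz] by simp_all
  have ne: "w \<noteq> x" "w \<noteq> y" "w \<noteq> z" using gen_ends_mem[OF xy] gen_ends_mem[OF yz] w by auto
  consider "d w x = 1" | "d z w = 1" | "d x w = 1" "d w z = 1" using orient[of w x] orient[of w z] V w ne by blast
  then show ?thesis
  proof cases
    case 1
    then show ?thesis using source_near[OF xy yz w 1] by force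
  next
    case 2
    then show ?thesis using sink_near[OF xy yz w 2] by force
  next
    case 3
    then show ?thesis using w by force
  qed
qed

text \<open>The arcs \<open>x \<rightarrow> y\<close> and \<open>z \<rightarrow> t\<close> are disjoint, and \<open>z \<rightarrow> x\<close> excludes that the second one precedes
  the first.\<close>
lemma path_dist:
  assumes xy: "gen l x y" and yz: "gen l y z" and zt: "gen l z t" and "t \<noteq> x"
  shows "d x t = 3"
proof -
  have V: "{x, y, z, t} \<subseteq> V" using gen_V[OF xy] gen_V[OF zt] by simp
  have xz: "x \<noteq> z" "y \<noteq> t"
    using local_facts[OF V, simplified] gen_dist[OF xy] gen_dist[OF yz] gen_dist[OF zt]
     gen_distinct[OF xy] gen_distinct[OF yz] gen_distinct[OF zt]  by (smt (z3))+
  show ?thesis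
  using gen_disjoint[OF xy zt xz(1) _ _ xz(2)] local_facts[OF V, simplified] gen_dist[OF xy] gen_dist[OF yz] gen_dist[OF zt]
    gen_consecutive[OF xy yz] gen_consecutive[OF yz zt] gen_distinct[OF xy] gen_distinct[OF yz] gen_distinct[OF zt] xz assms(4)
    by (smt (z3))
qed

text \<open>The vertex \<open>r\<close> comes from \<open>source_near\<close>, and \<open>q\<close> is a midpoint between \<open>x\<close> and \<open>r\<close>. It is
  off the line since it is dominated by \<open>x\<close> and at distance at most two from the path, hence
  neither before nor after it. As \<open>d x t = 3\<close>, it cannot dominate \<open>t\<close>, and so \<open>t\<close> and with it
  all path vertices dominate \<open>q\<close>.\<close>
lemma path_bottleneck_source:
  assumes xy: "gen l x y" and yz: "gen l y z" and zt: "gen l z t" and tx: "t \<noteq> x"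
    and w: "w \<in> V" "w \<notin> l" "d w x = 1"
  shows "\<exists>q\<in>V - l. \<exists>r\<in>V - l. d q r = 1 \<and> (\<forall>p\<in>{x,y,z,t}. d p q = 1 \<and> d r p = 1)"
proof -
  obtain r where r: "r \<in> V" "r \<notin> l" "d r x = 1" "d r y = 1" "d r z = 1" "d x r = 2"
    using source_near[OF xy yz w] by blast
  obtain q where q: "q \<in> V" "d x q = 1" "d q r = 1"
    using first_step[of x r 1] r gen_V[OF xy] by auto
  have S: "{x, y, z, t, q, r} \<subseteq> V" using gen_V[OF xy] gen_V[OF zt] q r by simp
  have mem: "x \<in> l" "y \<in> l" "z \<in> l" "t \<in> l" using gen_ends_mem[OF xy] gen_ends_mem[OF zt] by simp_all
  note facts = local_facts[OF S, simplified] q(2,3) r(3-6) path_dist[OF xy yz zt tx]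
    gen_dist[OF xy] gen_dist[OF yz] gen_dist[OF zt]
  have "q \<notin> {x, y, z}" using facts by (smt (z3) insertE singletonD)
  then have ql: "q \<notin> l" using gen_through[OF xy yz _ q(1)] facts by (smt (z3) insertCI)
  have ne: "q \<noteq> x" "q \<noteq> y" "q \<noteq> z" "q \<noteq> t" "r \<noteq> t" using ql r(2) mem by blast+
  have "d r t = 1" "d y q = 1" "d z q = 1" "d t q = 1"
    using facts ne gen_nonmem[OF xy q(1) ql] gen_nonmem[OF yz q(1) ql] gen_nonmem[OF zt q(1) ql]
     gen_nonmem[OF zt r(1,2)] by (smt (z3))+
  then show ?thesis using q r ql by blast
qed

text \<open>Since \<open>d x t = 3\<close>, a vertex that does not dominate \<open>x\<close> is dominated by \<open>t\<close>, so the previous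
  lemma applies directly or after reversal, which exchanges \<open>q\<close> and \<open>r\<close>.\<close>
lemma path_bottleneck:
  assumes xy: "gen l x y" and yz: "gen l y z" and zt: "gen l z t" and "t \<noteq> x" and w: "w \<in> V" "w \<notin> l"
  shows "\<exists>q\<in>V - l. \<exists>r\<in>V - l. d q r = 1 \<and> (\<forall>p\<in>{x,y,z,t}. d p q = 1 \<and> d r p = 1)"
proof -
  have V: "x \<in> V" "t \<in> V" and wt: "w \<noteq> x" "w \<noteq> t" 
    using gen_V[OF xy] gen_V[OF zt] gen_ends_mem[OF xy] gen_ends_mem[OF zt] w by auto
  show ?thesis
  proof (cases "d w x = 1")
    case True
    then show ?thesis using path_bottleneck_source[OF assms(1-6)] by blast
  next
    case False
    then have xw: "d x w = 1" using orient[of x w] V w wt by blast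
    interpret rev: tournament_distance V "\<lambda>x y. d y x" by (rule reverse)
    have "d x t \<le> d x w + d w t" using triangle V w by blast
    then have "d w t \<noteq> 1" using path_dist[OF xy yz zt assms(4)] xw by linarith
    then have "d t w = 1" using orient[of w t] V w wt by blast
    then have "\<exists>q\<in>V - l. \<exists>r\<in>V - l. d r q = 1 \<and> (\<forall>p\<in>{t,z,y,x}. d q p = 1 \<and> d p r = 1)"
      using rev.path_bottleneck_source[of l t z y x w, unfolded gen_reverse, OF zt yz xy assms(4)[symmetric] w] by blast
    then show ?thesis by blast
  qed
qed

section \<open>Three consecutive arcs are a whole class\<close>

text \<open>Preceding is inherited by the next arc: otherwise \<open>y \<rightarrow> z\<close> would precede \<open>u \<rightarrow> v\<close>, which
  precedes \<open>x \<rightarrow> y\<close>, although \<open>z \<rightarrow> x\<close>.\<close>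
lemma before_consecutive:
  assumes xy: "gen l x y" and yz: "gen l y z" and uv: "gen l u v"
    and ne: "u \<noteq> y" "u \<noteq> z" "v \<noteq> y" "v \<noteq> z" and before: "d u y = d v x + 2"
  shows "d u z = d v y + 2" "d v y = d v x + 1"
proof -
  have S: "{x, y, z, u, v} \<subseteq> V" using gen_V[OF xy] gen_V[OF yz] gen_V[OF uv] by simp
  have "d u z = d v y + 2 \<or> d y v = d z u + 2" using gen_disjoint[OF yz uv] ne by blast
  then show "d u z = d v y + 2" "d v y = d v x + 1"
    using local_facts[OF S, simplified] gen_dist[OF xy] gen_dist[OF yz] gen_dist[OF uv]
      gen_consecutive[OF xy yz] before ne gen_distinct[OF xy] gen_distinct[OF yz] gen_distinct[OF uv]
    by (smt (z3))+
qed

text \<open>A path of four arcs would be a geodesic from \<open>x\<close> to \<open>r\<close>, but the bottleneck \<open>q \<rightarrow> s\<close> of its first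
  three arcs connects \<open>x\<close> to \<open>r\<close> in three steps: \<open>s\<close> dominates \<open>t\<close> and hence \<open>r\<close>.\<close>
lemma path_extension:
  assumes xy: "gen l x y" and yz: "gen l y z" and zt: "gen l z t" and tx: "t \<noteq> x" and tr: "gen l t r"
    and w: "w \<in> V" "w \<notin> l"
  shows False
proof -
  obtain q s where q: "q \<in> V" "q \<notin> l" and s: "s \<in> V" "s \<notin> l" and qs: "d q s = 1"
    "d x q = 1" "d s y = 1" "d s t = 1"
    using path_bottleneck[OF xy yz zt tx w] by blast
  have S: "{x, y, z, t, r} \<subseteq> V" using gen_V[OF xy] gen_V[OF zt] gen_V[OF tr] by simp
  note facts = local_facts[OF S, simplified] gen_dist[OF xy] gen_dist[OF yz] gen_dist[OF zt] gen_dist[OF tr]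
    gen_consecutive[OF xy yz] gen_consecutive[OF yz zt] gen_consecutive[OF zt tr]
    path_dist[OF xy yz zt tx] tx
  have ne: "x \<noteq> t" "x \<noteq> r" "y \<noteq> t" using facts gen_consecutive[OF zt, of x] tr by (smt (z3))+
  have ry: "y \<noteq> r" using gen_same_head[OF xy, of t] tr tx by blast
  have "d x r \<ge> 4" using gen_disjoint[OF xy tr ne(1,2,3) ry] facts by (smt (z3))
  moreover have "d s r \<le> d s t" using gen_nonmem[OF tr s] by blast
  moreover have "d x r \<le> d x q + d q r" "d q r \<le> d q s + d s r"
    using triangle S q(1) s(1) by blast+
  ultimately show False using qs by linarith
qed

lemma path_no_before:
  assumes xy: "gen l x y" and yz: "gen l y z" and zt: "gen l z t" and tx: "t \<noteq> x" and uv: "gen l u v"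
    and disj: "{u, v} \<inter> {x, y, z, t} = {}" and w: "w \<in> V" "w \<notin> l"
  shows "d u y \<noteq> d v x + 2"
proof
  assume before: "d u y = d v x + 2"
  obtain q r where q: "q \<in> V" "q \<notin> l" and r: "r \<in> V" and qr: "d q r = 1" "d x q = 1" "d r t = 1"
    using path_bottleneck[OF xy yz zt tx w] by blast
  have V: "x \<in> V" "t \<in> V" "u \<in> V" "v \<in> V" using gen_V[OF xy] gen_V[OF zt] gen_V[OF uv] by auto
  have 1: "d u z = d v y + 2" "d v y = d v x + 1"
    using before_consecutive[OF xy yz uv _ _ _ _ before] disj by blast+
  have 2: "d u t = d v z + 2" "d v z = d v y + 1"
    using before_consecutive[OF yz zt uv _ _ _ _ 1(1)] disj by blast+
  \<comment> \<open>Since \<open>q\<close> is off the line, stepping from \<open>u\<close> to \<open>v\<close> does not bring it closer, so the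
      detour from \<open>u\<close> through \<open>q\<close> and \<open>r\<close> to \<open>t\<close> beats the supposed geodesic along the path.\<close>
  have "d u q \<le> d v q" using gen_nonmem[OF uv q] by blast
  also have "d v q \<le> d v x + d x q" using triangle V q(1) by blast
  finally have "d u q \<le> d v x + 1" using qr by linarith
  moreover have "d u t \<le> d u q + d q t" "d q t \<le> d q r + d r t" using triangle V q(1) r by blast+
  ultimately show False using 1 2 qr by linarith
qed

text \<open>As \<open>u \<rightarrow> v\<close> precedes \<open>z \<rightarrow> t\<close> at some distance, \<open>u \<rightarrow> q \<rightarrow> r \<rightarrow> t\<close> would be too short. So \<open>q\<close> dominates
  \<open>u\<close> and, being off the line, also \<open>v\<close>; but then \<open>x \<rightarrow> q \<rightarrow> v\<close> is too short for \<open>x \<rightarrow> y\<close> to precede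
  \<open>u \<rightarrow> v\<close>.\<close>
lemma path_no_middle:
  assumes xy: "gen l x y" and yz: "gen l y z" and zt: "gen l z t" and tx: "t \<noteq> x" and uv: "gen l u v"
    and disj: "{u, v} \<inter> {x, y, z, t} = {}" and w: "w \<in> V" "w \<notin> l"
    and mid: "d x v = d y u + 2" "d u z = d v y + 2" 
  shows False
proof -
  obtain q r where q: "q \<in> V" "q \<notin> l" and r: "r \<in> V" and qr: "d q r = 1" "d x q = 1" "d r t = 1"
    using path_bottleneck[OF xy yz zt tx w] by blast
  have V: "x \<in> V" "y \<in> V" "t \<in> V" "u \<in> V" "v \<in> V" "z \<in> V" using gen_V[OF xy] gen_V[OF zt] gen_V[OF uv] by auto
  have 2: "d u t = d v z + 2" "d v z = d v y + 1"
    using before_consecutive[OF yz zt uv _ _ _ _ mid(2)] disj by blast+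
  have "d y u \<noteq> 0" "d v y \<noteq> 0" "u \<noteq> q" "v \<noteq> q" using dist_zero V disj gen_ends_mem[OF uv] q(2) by blast+
  moreover have "d u t \<le> d u q + d q t" "d q t \<le> d q r + d r t" using triangle V q(1) r by blast+
  ultimately have "d u q \<noteq> 1" using 2 qr by linarith
  then have "d q u = 1" using orient[of u q] V q(1) \<open>u \<noteq> q\<close> by blast
  then have "d q v \<le> 1" using gen_nonmem[OF uv q] by linarith
  moreover have "d x v \<le> d x q + d q v" using triangle V q(1) by blast
  ultimately show False using mid(1) qr \<open>d y u \<noteq> 0\<close> by linarith
qed

text \<open>A further arc cannot share a vertex with the path. If it is disjoint from it, it comes after
  \<open>x \<rightarrow> y\<close> and before \<open>z \<rightarrow> t\<close>, and then it is in the middle, relative to the path or to its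
  reversal.\<close>
lemma path_isolated:
  assumes xy: "gen l x y" and yz: "gen l y z" and zt: "gen l z t" and tx: "t \<noteq> x" and uv: "gen l u v"
    and w: "w \<in> V" "w \<notin> l"
  shows "(u, v) \<in> {(x, y), (y, z), (z, t)}"
proof (rule ccontr)
  assume other: "(u, v) \<notin> {(x, y), (y, z), (z, t)}"
  interpret rev: tournament_distance V "\<lambda>x y. d y x" by (rule reverse)
  have "u \<noteq> x" "u \<noteq> y" "u \<noteq> z" "v \<noteq> y" "v \<noteq> z" "v \<noteq> t"
    using other uv gen_same_tail[OF xy, of v] gen_same_tail[OF yz, of v] gen_same_tail[OF zt, of v]
      gen_same_head[OF xy, of u] gen_same_head[OF yz, of u] gen_same_head[OF zt, of u] by blast+
  moreover have "u \<noteq> t" using path_extension[OF xy yz zt tx _ w] uv by blast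
  moreover have "v \<noteq> x"
    using rev.path_extension[of l t z y x u w, unfolded gen_reverse, OF zt yz xy tx[symmetric] _ w] uv by blast
  ultimately have disj: "{u, v} \<inter> {x, y, z, t} = {}" and disj': "{v, u} \<inter> {t, z, y, x} = {}" by blast+
  have no: "d u y \<noteq> d v x + 2" using path_no_before[OF xy yz zt tx uv disj w] .
  have no': "d z v \<noteq> d t u + 2"
    using rev.path_no_before[of l t z y x v u w, unfolded gen_reverse, OF zt yz xy tx[symmetric] uv disj' w] .
  have xv: "d x v = d y u + 2" using gen_disjoint[OF xy uv] no disj by blast
  have ut: "d u t = d v z + 2" using gen_disjoint[OF zt uv] no' disj by blast
  have "d u z = d v y + 2 \<or> d y v = d z u + 2" using gen_disjoint[OF yz uv] disj by blast
  then show False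
  proof
    assume "d u z = d v y + 2"
    then show False using path_no_middle[OF xy yz zt tx uv disj w xv] by blast
  next
    assume "d y v = d z u + 2"
    then show False
      using rev.path_no_middle[of l t z y x v u w, unfolded gen_reverse, OF zt yz xy tx[symmetric] uv disj' w ut] by blast
  qed
qed

section \<open>Two inner vertices force three consecutive arcs\<close>

text \<open>If one path precedes the other, then \<open>d a z = d c x + 4\<close>. But a vertex \<open>r\<close> as in \<open>near\<close> is
  no farther from \<open>a\<close> than from \<open>c\<close>, and so provides a path of length at most \<open>d c x + 3\<close>.\<close>
lemma nested_paths:
  assumes ab: "gen l a b" and bc: "gen l b c" and xy: "gen l x y" and yz: "gen l y z"
    and disj: "{a, b, c} \<inter> {x, y, z} = {}" and w: "w \<in> V" "w \<notin> l"
  shows "d b y \<noteq> d c x + 2"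
proof
  assume before: "d b y = d c x + 2"
  have V: "a \<in> V" "b \<in> V" "c \<in> V" "x \<in> V" "y \<in> V" "z \<in> V"
    using gen_V[OF ab] gen_V[OF bc] gen_V[OF xy] gen_V[OF yz] by simp_all
  interpret rev: tournament_distance V "\<lambda>x y. d y x" by (rule reverse)
  obtain r where r: "r \<in> V" "r \<notin> l" "d x r + d r z \<le> 3" using near[OF xy yz w] by blast
  have 1: "d b z = d c y + 2" "d c y = d c x + 1"
    using before_consecutive[OF xy yz bc _ _ _ _ before] disj by blast+
  have 2: "d a z = d b y + 2"
    using rev.before_consecutive[of l c b a z y, unfolded gen_reverse, OF bc ab yz _ _ _ _ 1(1)] disj by blast
  have "d a r \<le> d c r" using gen_nonmem[OF ab r(1,2)] gen_nonmem[OF bc r(1,2)] by linarith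
  moreover have "d c r \<le> d c x + d x r" "d a z \<le> d a r + d r z" using triangle V r(1) by blast+
  ultimately show False using before 1 2 r(3) by linarith
qed

text \<open>Here \<open>a \<rightarrow> b\<close>, \<open>x \<rightarrow> y\<close>, \<open>b \<rightarrow> c\<close>, \<open>y \<rightarrow> z\<close> alternate, so that \<open>d a z\<close> is at least four and \<open>d x c\<close>
  at least three. These bounds leave only two kinds of vertices off the line: those that
  dominate both paths and those that are dominated by both. In the first case \<open>source_near\<close>
  yields one that is at distance two from \<open>a\<close> and still dominates \<open>z\<close>, contradicting the bound on
  \<open>d a z\<close>; the second case is the mirror image.\<close>
lemma interlaced_paths:
  assumes ab: "gen l a b" and bc: "gen l b c" and xy: "gen l x y" and yz: "gen l y z"
    and disj: "{a, b, c} \<inter> {x, y, z} = {}" and w: "w \<in> V" "w \<notin> l"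
    and abxy: "d a y = d b x + 2" and abyz: "d a z = d b y + 2"
    and xybc: "d x c = d y b + 2" and bcyz: "d b z = d c y + 2"
  shows False
proof -
  have V: "a \<in> V" "b \<in> V" "c \<in> V" "x \<in> V" "y \<in> V" "z \<in> V"
    using gen_V[OF ab] gen_V[OF bc] gen_V[OF xy] gen_V[OF yz] by simp_all
  have ne: "a \<noteq> x" "a \<noteq> y" "a \<noteq> z" "b \<noteq> x" "b \<noteq> y" "b \<noteq> z" "c \<noteq> x" "c \<noteq> y" "c \<noteq> z" using disj by blast+
  have dists: "d a z \<ge> 4" "d x c \<ge> 3" "d y b \<noteq> 0" 
  proof -
    show "d y b \<noteq> 0" using dist_zero[of y b] V ne by blast
    then show "d x c \<ge> 3" using xybc by linarith
    have "d b x \<noteq> 0" using dist_zero[of b x] V ne by blast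
    moreover have "d b y = d b x + 1"
      using before_consecutive(2)[OF xy yz ab _ _ _ _ abxy] ne by blast
    ultimately show "d a z \<ge> 4" using abyz by linarith
  qed
  \<comment> \<open>The arithmetic constraints on a vertex off the line, collected for the case distinction.\<close>
  have out: "d a q + d q z \<ge> 4 \<and> d x q + d q c \<ge> 3 \<and>
     d q x \<noteq> 0 \<and> d x q \<noteq> 0 \<and> d q z \<noteq> 0 \<and> d z q \<noteq> 0 \<and> d q a \<noteq> 0 \<and> d a q \<noteq> 0 \<and> d q c \<noteq> 0 \<and> d c q \<noteq> 0 \<and>
     (d q x = 1 \<longleftrightarrow> d x q \<noteq> 1) \<and> (d q z = 1 \<longleftrightarrow> d z q \<noteq> 1) \<and> (d q a = 1 \<longleftrightarrow> d a q \<noteq> 1) \<and> (d q c = 1 \<longleftrightarrow> d c q \<noteq> 1) \<and>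
     d x q \<le> d z q \<and> d q z \<le> d q x \<and> d a q \<le> d c q \<and> d q c \<le> d q a"
    if q: "q \<in> V" "q \<notin> l" for q
  proof -
    have "q \<noteq> x" "q \<noteq> z" "q \<noteq> a" "q \<noteq> c"
      using gen_ends_mem[OF ab] gen_ends_mem[OF bc] gen_ends_mem[OF xy] gen_ends_mem[OF yz] q(2) by blast+
    note orient[of q x] orient[of q z] orient[of q a] orient[of q c] dist_zero[of q x] dist_zero[of q z] dist_zero[of q a]
      dist_zero[of q c] dist_zero[of x q] dist_zero[of z q] dist_zero[of a q] dist_zero[of c q] this
    moreover have "d a z \<le> d a q + d q z" "d x c \<le> d x q + d q c" using triangle V q(1) by blast+
    moreover note gen_nonmem[OF ab q] gen_nonmem[OF bc q] gen_nonmem[OF xy q] gen_nonmem[OF yz q]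
    ultimately show ?thesis using dists V q(1) by (smt (z3))
  qed
  have "d w c = 1 \<or> d x w = 1" using out[OF w] by (smt (z3))
  then show False
  proof
    assume "d w c = 1"
    then have "d w a = 1" using out[OF w] by (smt (z3))
    then obtain q where "q \<in> V" "q \<notin> l" "d q c = 1" "d a q = 2"
      using source_near[OF ab bc w] by blast
    then show False using out[of q] by (smt (z3))
  next
    assume "d x w = 1"
    then have "d z w = 1" using out[OF w] by (smt (z3))
    then obtain q where "q \<in> V" "q \<notin> l" "d x q = 1" "d q z = 2"
      using sink_near[OF xy yz w] by blast
    then show False using out[of q] by (smt (z3))
  qed
qed

text \<open>An arc preceded by \<open>x \<rightarrow> y\<close> and preceding \<open>y \<rightarrow> z\<close> forms a directed triangle with \<open>y\<close>.\<close>
lemma between: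
  assumes xy: "gen l x y" and yz: "gen l y z" and uv: "gen l u v"
    and "d x v = d y u + 2" "d u z = d v y + 2"
    and "u \<noteq> x" "u \<noteq> y" "u \<noteq> z" "v \<noteq> x" "v \<noteq> y" "v \<noteq> z"
  shows "d y u = 1" "d v y = 1"
proof -
  have S: "{x, y, z, u, v} \<subseteq> V" using gen_V[OF xy] gen_V[OF yz] gen_V[OF uv] by simp
  show "d y u = 1" "d v y = 1"
    using local_facts[OF S, simplified] gen_dist[OF xy] gen_dist[OF yz] gen_dist[OF uv]
      gen_consecutive[OF xy yz] assms(4-) by (smt (z3))+
qed

text \<open>By \<open>nested_paths\<close>, \<open>x \<rightarrow> y\<close> precedes \<open>b \<rightarrow> c\<close> and \<open>a \<rightarrow> b\<close> precedes \<open>y \<rightarrow> z\<close>. Two of the remaining four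
  configurations are interlaced. In the other two, both arcs of one path lie between the arcs
  of the other path, and \<open>between\<close> orients the pair of inner vertices in both directions.\<close>
lemma disjoint_paths:
  assumes ab: "gen l a b" and bc: "gen l b c" and xy: "gen l x y" and yz: "gen l y z"
    and disj: "{a, b, c} \<inter> {x, y, z} = {}" and w: "w \<in> V" "w \<notin> l"
  shows False
proof -
  have disj': "{x, y, z} \<inter> {a, b, c} = {}" using disj by blast
  have V: "a \<in> V" "b \<in> V" "c \<in> V" "x \<in> V" "y \<in> V" "z \<in> V"
    using gen_V[OF ab] gen_V[OF bc] gen_V[OF xy] gen_V[OF yz] by simp_all
  have ne: "a \<noteq> x" "a \<noteq> y" "a \<noteq> z" "b \<noteq> x" "b \<noteq> y" "b \<noteq> z" "c \<noteq> x" "c \<noteq> y" "c \<noteq> z" using disj by blast+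
  have bcxy: "d x c = d y b + 2"
    using gen_disjoint[OF xy bc] nested_paths[OF assms] ne by blast
  have yzab: "d a z = d b y + 2"
    using gen_disjoint[OF yz ab] nested_paths[OF xy yz ab bc disj' w] ne by blast
  have A: "d a y = d b x + 2 \<or> d x b = d y a + 2" using gen_disjoint[OF xy ab] ne by blast
  have B: "d b z = d c y + 2 \<or> d y c = d z b + 2" using gen_disjoint[OF yz bc] ne by blast
  show False
  proof (cases "d a y = d b x + 2")
    case True
    show ?thesis
    proof (cases "d b z = d c y + 2")
      case True
      then show ?thesis using interlaced_paths[OF assms \<open>d a y = d b x + 2\<close> yzab bcxy] by blast
    next
      case False
      then have "d y c = d z b + 2" using B by blast
      then have "d y b = 1" "d b y = 1"
        using between[OF ab bc xy True bcxy] between[OF ab bc yz yzab] ne by blast+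
      then show ?thesis using orient[of b y] V ne by blast
    qed
  next
    case False
    show ?thesis
    proof (cases "d b z = d c y + 2")
      case True
      have "d x b = d y a + 2" using A False by blast
      then have "d y b = 1" "d b y = 1"
        using between[OF xy yz ab _ yzab] between[OF xy yz bc bcxy True] ne by blast+
      then show ?thesis using orient[of b y] V ne by blast
    next
      case B': False
      then show ?thesis
        using interlaced_paths[OF xy yz ab bc disj' w _ bcxy yzab] A B False by blast
    qed
  qed
qed

section \<open>Counting the arcs of a class\<close>

definition generators :: "'a set \<Rightarrow> ('a \<times> 'a) set" where
  "generators l = {(x, y). gen l x y}"

definition arcs_of :: "('a \<times> 'a) set" where
  "arcs_of = {(x, y). x \<in> V \<and> y \<in> V \<and> d x y = 1}"

lemma class_subset: "generators l \<subseteq> V \<times> V"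
  by (auto simp: generators_def gen_def)

lemma finite_class: "finite (generators l)"
  using class_subset finite_V by (meson finite_SigmaI finite_subset)

lemma twice_card_class:
  "2 * card (generators l) = card (fst ` generators l \<union> snd ` generators l) + card (fst ` generators l \<inter> snd ` generators l)"
proof -
  have "inj_on fst (generators l)" "inj_on snd (generators l)"
    by (auto simp: inj_on_def generators_def dest: gen_same_tail gen_same_head)
  then have "card (fst ` generators l) = card (generators l)" "card (snd ` generators l) = card (generators l)"
    by (simp_all add: card_image)
  then show ?thesis
    using card_Un_Int[of "fst ` generators l" "snd ` generators l"] finite_class by simp
qed

lemma ends_card:
  assumes "generators l \<noteq> {}" and w: "w \<in> V" "w \<notin> l"
  shows "card (fst ` generators l \<union> snd ` generators l) + 2 \<le> card V"
proof -
  obtain u v where uv: "gen l u v" using assms(1) by (auto simp: generators_def)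
  obtain p where p: "p \<in> V" "p \<noteq> w" "\<forall>q. \<not> gen l p q \<and> \<not> gen l q p"
    using uncovered_vertex[OF uv w] by blast
  let ?E = "fst ` generators l \<union> snd ` generators l"
  have "p \<notin> ?E" using p(3) by (auto simp: generators_def)
  moreover have "w \<notin> ?E" using gen_ends_mem w(2) by (fastforce simp: generators_def)
  moreover have "?E \<subseteq> V" using class_subset by fastforce
  moreover have fin: "finite ?E" using finite_class by blast
  ultimately have "card (insert p (insert w ?E)) = card ?E + 2" "insert p (insert w ?E) \<subseteq> V"
    using p(1,2) w(1) by simp_all
  then show ?thesis using card_mono[OF finite_V, of "insert p (insert w ?E)"] by simp
qed

lemma triangle_class:
  assumes "gen l x y" "gen l y z" "gen l z x"
  shows "generators l = {(x, y), (y, z), (z, x)}"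
proof -
  have "(u, v) \<in> {(x, y), (y, z), (z, x)}" if "gen l u v" for u v
    using gen_ends_mem(1)[OF that] triangle_line[OF assms] gen_same_tail[OF that] assms by blast
  then show ?thesis using assms by (auto simp: generators_def)
qed

lemma path_class:
  assumes "gen l x y" "gen l y z" "gen l z t" "t \<noteq> x" "w \<in> V" "w \<notin> l"
  shows "generators l = {(x, y), (y, z), (z, t)}"
  using path_isolated[OF assms(1-4) _ assms(5,6)] assms(1-3) by (auto simp: generators_def)

text \<open>Without three consecutive arcs, the two paths around distinct inner vertices are disjoint.\<close>
lemma three_consecutive_arcs:
  assumes xy: "gen l x y" and yz: "gen l y z" and xy': "gen l x' y'" and yz': "gen l y' z'"
    and ne: "y \<noteq> y'" and w: "w \<in> V" "w \<notin> l"
  shows "\<exists>a b c e. gen l a b \<and> gen l b c \<and> gen l c e"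
proof (rule ccontr)
  assume no: "\<not> ?thesis"
  have "x \<noteq> x'" "z \<noteq> z'" using gen_same_tail[OF xy] gen_same_head[OF yz] xy' yz' ne by blast+
  moreover have "x \<noteq> z'" "y \<noteq> x'" "y \<noteq> z'" "z \<noteq> x'" "z \<noteq> y'" "x \<noteq> y'" using no xy yz xy' yz' by blast+
  ultimately have "{x, y, z} \<inter> {x', y', z'} = {}" using ne by blast
  then show False using disjoint_paths[OF xy yz xy' yz' _ w] by blast
qed

text \<open>With at most one inner vertex the bound is \<open>ends_card\<close>. Otherwise the class is a path of three
  arcs, and its bottleneck \<open>q \<rightarrow> r\<close> generates a line with at least six vertices. That this line is
  not universal leaves room for a seventh vertex.\<close>
lemma class_bound:
  assumes ne: "generators l \<noteq> {}" and w: "w \<in> V" "w \<notin> l"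
    and no_universal: "\<And>p q. p \<in> V \<Longrightarrow> q \<in> V \<Longrightarrow> d p q = 1 \<Longrightarrow> arc_line p q \<noteq> V"
    and no_triangle: "\<And>x y z. \<not> (gen l x y \<and> gen l y z \<and> gen l z x)"
  shows "2 * card (generators l) \<le> card V - 1"
proof (cases "\<exists>x y z t. gen l x y \<and> gen l y z \<and> gen l z t")
  case False
  have "y = y'" if "y \<in> fst ` generators l \<inter> snd ` generators l" "y' \<in> fst ` generators l \<inter> snd ` generators l" for y y'
  proof -
    have "\<exists>x z. gen l x y \<and> gen l y z" "\<exists>x z. gen l x y' \<and> gen l y' z" using that by (auto simp: generators_def)
    then obtain x z x' z' where "gen l x y" "gen l y z" "gen l x' y'" "gen l y' z'" by blast
    then show ?thesis using three_consecutive_arcs[of l x y z x' y' z' w] w False by blast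
  qed
  then have "card (fst ` generators l \<inter> snd ` generators l) \<le> 1"
    using card_le_Suc0_iff_eq[of "fst ` generators l \<inter> snd ` generators l"] finite_class[of l]
    by (metis One_nat_def finite_Int finite_imageI)
  then show ?thesis using twice_card_class[of l] ends_card[OF ne w] by linarith
next
  case True
  then obtain x y z t where p: "gen l x y" "gen l y z" "gen l z t" by blast
  then have tx: "t \<noteq> x" using no_triangle by blast
  have dist: "x \<noteq> y" "y \<noteq> z" "z \<noteq> t" using p gen_distinct by blast+
  have xz: "x \<noteq> z" "y \<noteq> t"
    using gen_consecutive[OF p(1,2)] gen_consecutive[OF p(2,3)] dist_zero gen_V[OF p(1)] gen_V[OF p(3)]
    by (metis zero_neq_one)+
  have gens: "generators l = {(x, y), (y, z), (z, t)}" using path_class[OF p tx w] .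
  obtain q r where q: "q \<in> V" "q \<notin> l" and r: "r \<in> V" "r \<notin> l" and qr: "d q r = 1"
    "\<And>p. p \<in> {x, y, z, t} \<Longrightarrow> d p q = 1 \<and> d r p = 1" using path_bottleneck[OF p tx w] by blast
  have P: "{x, y, z, t} \<subseteq> l" "{x, y, z, t} \<subseteq> V"
    using gen_ends_mem[OF p(1)] gen_ends_mem[OF p(3)] gen_V[OF p(1)] gen_V[OF p(3)] by simp_all
  have "q \<noteq> r" using qr(1) dist_zero[of q q] q by auto
  have line: "p \<in> arc_line q r" if "p \<in> {x, y, z, t}" for p
  proof -
    have V: "{p, q, r} \<subseteq> V" using that P q r by blast
    have "p \<noteq> r" using that P r by blast
    then have "d p r = d p q + 1" 
      using local_facts[OF V, simplified] qr(1) qr(2)[OF that] by (smt (z3))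
    then show ?thesis using V by (simp add: arc_line_def)
  qed
  have "q \<in> arc_line q r" "r \<in> arc_line q r"
    using q r qr(1) dist_zero[of q q] dist_zero[of r r] by (simp_all add: arc_line_def)
  then have sub: "{x, y, z, t, q, r} \<subseteq> arc_line q r" using line by blast
  moreover have "arc_line q r \<subseteq> V" by (auto simp: arc_line_def)
  ultimately have "{x, y, z, t, q, r} \<subset> V" using no_universal[OF q(1) r(1) qr(1)] by blast
  then have "card {x, y, z, t, q, r} < card V" using finite_V psubset_card_mono by blast
  moreover have "card {x, y, z, t, q, r} = 6" 
  proof -
    have "x \<noteq> q" "y \<noteq> q" "z \<noteq> q" "t \<noteq> q" "x \<noteq> r" "y \<noteq> r" "z \<noteq> r" "t \<noteq> r" using P(1) q(2) r(2) by blast+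
    then show ?thesis using dist xz tx \<open>q \<noteq> r\<close> by simp
  qed
  moreover have "card (generators l) \<le> 3" unfolding gens by (simp add: card_insert_if)
  ultimately show ?thesis by linarith
qed

text \<open>The vertices \<open>u\<close> and \<open>v\<close> of the second triangle are off the first line. So going round the first
  triangle, \<open>c \<rightarrow> u\<close> entails \<open>b \<rightarrow> u\<close> and \<open>a \<rightarrow> u\<close>, and \<open>v \<rightarrow> c\<close> entails \<open>v \<rightarrow> a\<close>. But then \<open>a\<close>, which is off
  the second line, must be dominated by \<open>u\<close> because it is dominated by \<open>v\<close>.\<close>
lemma triangle_classes_disjoint:
  assumes 1: "gen l c a" "gen l a b" "gen l b c" and 2: "gen m c u" "gen m u v" "gen m v c"
  shows "l = m"
proof (rule ccontr)
  assume "l \<noteq> m"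
  have V: "a \<in> V" "b \<in> V" "c \<in> V" "u \<in> V" "v \<in> V"
    using gen_V[OF 1(1)] gen_V[OF 1(2)] gen_V[OF 2(2)] by simp_all
  have line: "l = {c, a, b}" "m = {c, u, v}" using triangle_line[OF 1] triangle_line[OF 2] by simp_all
  have "u \<noteq> a" "v \<noteq> b" using \<open>l \<noteq> m\<close> 1 2 by (auto simp: gen_def)
  moreover have "u \<noteq> b" "v \<noteq> a" "u \<noteq> c" "v \<noteq> c"
    using gen_dist[OF 1(1)] gen_dist[OF 1(3)] gen_dist[OF 2(1)] gen_dist[OF 2(3)] orient[of c b] orient[of a c]
      gen_distinct 1 2 V by metis+
  moreover have "a \<noteq> c" "b \<noteq> c" using gen_distinct 1 by blast+
  ultimately have out: "u \<notin> l" "v \<notin> l" "a \<notin> m" using line by blast+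
  have "d a u \<le> d b u" "d b u \<le> d c u" "d v a \<le> d v c" "d u a \<le> d v a"
    using gen_nonmem(1)[OF 1(2) V(4) out(1)] gen_nonmem(1)[OF 1(3) V(4) out(1)]
      gen_nonmem(2)[OF 1(1) V(5) out(2)] gen_nonmem(1)[OF 2(2) V(1) out(3)] .
  moreover have "d c u = 1" "d v c = 1" using gen_dist 2 by blast+
  moreover have "d a u \<noteq> 0" "d u a \<noteq> 0" using dist_zero V \<open>u \<noteq> a\<close> by blast+
  ultimately show False using orient[of a u] V \<open>u \<noteq> a\<close> by (smt (z3))
qed

section \<open>Counting the lines\<close>

definition all_lines :: "'a set set" where
  "all_lines = {arc_line x y | x y. x \<in> V \<and> y \<in> V \<and> d x y = 1}"

definition triangle_lines :: "'a set set" where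
  "triangle_lines = {l. \<exists>x y z. gen l x y \<and> gen l y z \<and> gen l z x}"

lemma finite_all_lines: "finite all_lines"
proof -
  have "all_lines \<subseteq> Pow V" by (auto simp: all_lines_def arc_line_def)
  then show ?thesis using finite_V finite_subset by blast
qed

lemma triangle_lines_subset: "triangle_lines \<subseteq> all_lines"
  by (auto simp: triangle_lines_def all_lines_def gen_def)

lemma card_triangle_line:
  assumes "l \<in> triangle_lines" shows "card l = 3" "card (generators l) = 3" "l \<subseteq> V"
proof -
  obtain x y z where t: "gen l x y" "gen l y z" "gen l z x" using assms by (auto simp: triangle_lines_def)
  have "x \<noteq> y" "y \<noteq> z" "z \<noteq> x" using gen_distinct t by blast+
  then show "card l = 3" "card (generators l) = 3" using triangle_line[OF t] triangle_class[OF t] by auto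
  show "l \<subseteq> V" using t(1) by (auto simp: gen_def arc_line_def)
qed

lemma triangle_lines_count: "3 * card triangle_lines \<le> card V"
proof -
  have rotate: "\<exists>a b. gen l c a \<and> gen l a b \<and> gen l b c" if l: "l \<in> triangle_lines" and c: "c \<in> l" for l c
  proof -
    obtain x y z where t: "gen l x y" "gen l y z" "gen l z x" using l by (auto simp: triangle_lines_def)
    then have "c = x \<or> c = y \<or> c = z" using triangle_line[OF t] c by blast
    then show ?thesis using t by blast
  qed
  have disj: "pairwise disjnt triangle_lines"
  proof (rule pairwiseI)
    fix l m assume "l \<in> triangle_lines" "m \<in> triangle_lines" "l \<noteq> m"
    then show "disjnt l m" using rotate triangle_classes_disjoint by (metis disjnt_iff)
  qed
  have "card (\<Union>triangle_lines) = (\<Sum>l\<in>triangle_lines. card l)"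
    using card_Union_disjoint[OF disj] finite_subset[OF card_triangle_line(3) finite_V] by simp
  also have "\<dots> = 3 * card triangle_lines" using card_triangle_line by simp
  finally have "3 * card triangle_lines = card (\<Union>triangle_lines)" ..
  moreover have "\<Union>triangle_lines \<subseteq> V" using card_triangle_line(3) by blast
  ultimately show ?thesis using card_mono[OF finite_V, of "\<Union>triangle_lines"] by simp
qed

lemma twice_card_arcs: "2 * card arcs_of = card V * (card V - 1)"
proof -
  have fin: "finite arcs_of" by (rule finite_subset[of _ "V \<times> V"]) (auto simp: arcs_of_def finite_V)
  have "arcs_of \<inter> arcs_of\<inverse> = {}" using orient dist_zero by (fastforce simp: arcs_of_def)
  then have "card (arcs_of \<union> arcs_of\<inverse>) = 2 * card arcs_of"
    using fin by (simp add: card_Un_disjoint)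
  moreover have "arcs_of \<union> arcs_of\<inverse> = V \<times> V - (\<lambda>x. (x, x)) ` V"
  proof -
    have "(x, y) \<in> arcs_of \<union> arcs_of\<inverse> \<longleftrightarrow> x \<in> V \<and> y \<in> V \<and> x \<noteq> y" for x y
      using orient[of x y] dist_zero[of x x] unfolding arcs_of_def
      by (cases "x = y") (simp_all, blast)
    then show ?thesis by auto
  qed
  moreover have "card (V \<times> V - (\<lambda>x. (x, x)) ` V) = card V * card V - card V"
    using finite_V by (subst card_Diff_subset) (auto simp: card_cartesian_product card_image inj_on_def)
  ultimately show ?thesis by (simp add: diff_mult_distrib2)
qed

lemma sum_card_class: "(\<Sum>l\<in>all_lines. card (generators l)) = card arcs_of"
proof -
  have "arcs_of = (\<Union>l\<in>all_lines. generators l)"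
    by (auto simp: arcs_of_def generators_def gen_def all_lines_def)
  then show ?thesis
    using finite_all_lines finite_class
    by (simp, subst card_UN_disjoint) (auto simp: generators_def gen_def)
qed

text \<open>With \<open>K\<close> lines, \<open>t\<close> of them of triangle classes, counting arcs twice gives
  \<open>n (n - 1) \<le> (K - t) (n - 1) + 6 t\<close>, where \<open>3 t \<le> n\<close>. This implies \<open>n \<le> K\<close> except for
  \<open>t = 1\<close> and \<open>n = 3, 4\<close>, but a triangle class needs \<open>n \<ge> 5\<close> as it misses two vertices.\<close>
theorem many_lines:
  assumes "card V \<ge> 2"
    and no_universal: "\<And>p q. p \<in> V \<Longrightarrow> q \<in> V \<Longrightarrow> d p q = 1 \<Longrightarrow> arc_line p q \<noteq> V"
  shows "card V \<le> card all_lines"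
proof -
  let ?n = "card V" and ?t = "card triangle_lines"
  have sub: "l \<subset> V" "generators l \<noteq> {}" if "l \<in> all_lines" for l
    using that no_universal by (auto simp: all_lines_def arc_line_def generators_def gen_def)
  have fin: "finite triangle_lines" using finite_all_lines triangle_lines_subset finite_subset by blast
  have bound: "2 * card (generators l) \<le> ?n - 1" if l: "l \<in> all_lines - triangle_lines" for l
  proof -
    have lA: "l \<in> all_lines" using l by blast
    then obtain w where w: "w \<in> V" "w \<notin> l" using sub(1)[of l] by blast
    have no: "\<not> (gen l x y \<and> gen l y z \<and> gen l z x)" for x y z
      using l unfolding triangle_lines_def by blast
    show ?thesis by (rule class_bound[OF sub(2)[OF lA] w no_universal no])
  qed
  have "?n * (?n - 1) = (\<Sum>l\<in>all_lines. 2 * card (generators l))"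
    using twice_card_arcs sum_card_class by (simp flip: sum_distrib_left)
  also have "\<dots> = (\<Sum>l\<in>all_lines - triangle_lines. 2 * card (generators l)) + (\<Sum>l\<in>triangle_lines. 2 * card (generators l))"
    using triangle_lines_subset finite_all_lines by (rule sum.subset_diff)
  also have "(\<Sum>l\<in>triangle_lines. 2 * card (generators l)) = 6 * ?t"
    using card_triangle_line by simp
  also have "(\<Sum>l\<in>all_lines - triangle_lines. 2 * card (generators l)) \<le> card (all_lines - triangle_lines) * (?n - 1)"
    using sum_bounded_above[of "all_lines - triangle_lines" "\<lambda>l. 2 * card (generators l)" "?n - 1"] bound by simp
  also have "card (all_lines - triangle_lines) = card all_lines - ?t"
    using card_Diff_subset[OF fin triangle_lines_subset] .
  finally have total: "?n * (?n - 1) \<le> (card all_lines - ?t) * (?n - 1) + 6 * ?t" by simp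
  have t_le: "?t \<le> card all_lines" using card_mono[OF finite_all_lines triangle_lines_subset] .
  have "?n \<ge> 5" if t: "?t > 0"
  proof -
    obtain l where l: "l \<in> triangle_lines" using t by fastforce
    then obtain w where w: "w \<in> V" "w \<notin> l" using sub(1) triangle_lines_subset by blast
    have "generators l \<noteq> {}" using l sub(2) triangle_lines_subset by blast
    then have "card (fst ` generators l \<union> snd ` generators l) + 2 \<le> card V" using ends_card w by blast
    moreover have "fst ` generators l \<union> snd ` generators l = l"
    proof -
      obtain x y z where t: "gen l x y" "gen l y z" "gen l z x" using l by (auto simp: triangle_lines_def)
      have "fst ` generators l \<union> snd ` generators l = {x, y, z}"
        unfolding triangle_class[OF t] by auto
      also have "\<dots> = l" by (rule triangle_line[OF t, symmetric])
      finally show ?thesis .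
    qed
    ultimately show ?thesis using card_triangle_line(1)[OF l] by simp
  qed
  then have small: "7 \<le> ?n \<or> ?t = 0 \<or> ?n = 5 \<and> ?t \<le> 1 \<or> ?n = 6 \<and> ?t \<le> 2"
    using triangle_lines_count by linarith
  show ?thesis
  proof (cases "7 \<le> ?n \<or> ?t = 0")
    case True
    then have "6 * ?t \<le> ?t * (?n - 1)" by auto
    then have "?n * (?n - 1) \<le> (card all_lines - ?t + ?t) * (?n - 1)"
      using total unfolding add_mult_distrib by linarith
    then have "?n * (?n - 1) \<le> card all_lines * (?n - 1)" using t_le by simp
    then show ?thesis using assms(1) by simp
  next
    case False
    then have "?n = 5 \<and> ?t \<le> 1 \<or> ?n = 6 \<and> ?t \<le> 2" using small by argo
    then show ?thesis using total t_le by auto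
  qed
qed

end

section \<open>The distance of a strong tournament\<close>

locale strong_tournament = tournament +
  assumes strong: "strongly_connected G"
begin

definition hop_dist :: "'a \<Rightarrow> 'a \<Rightarrow> nat" where
  "hop_dist x y = (LEAST k. \<exists>p. awalk x p y \<and> length p = k)"

lemma hop_dist_le: "awalk x p y \<Longrightarrow> hop_dist x y \<le> length p"
  unfolding hop_dist_def by (rule Least_le) blast

lemma hop_dist_walk:
  assumes "x \<in> verts G" "y \<in> verts G"
  obtains p where "awalk x p y" "length p = hop_dist x y"
proof -
  have "x \<rightarrow>\<^sup>* y" using strong assms by (auto simp: strongly_connected_def)
  then have "\<exists>k p. awalk x p y \<and> length p = k" by (simp add: reachable_awalk)
  then have "\<exists>p. awalk x p y \<and> length p = hop_dist x y" unfolding hop_dist_def by (rule LeastI_ex)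
  then show ?thesis using that by blast
qed

lemma hop_dist_triangle:
  assumes "x \<in> verts G" "y \<in> verts G" "z \<in> verts G"
  shows "hop_dist x z \<le> hop_dist x y + hop_dist y z"
proof -
  obtain p where p: "awalk x p y" "length p = hop_dist x y" using hop_dist_walk assms(1,2) .
  obtain q where q: "awalk y q z" "length q = hop_dist y z" using hop_dist_walk assms(2,3) .
  show ?thesis using hop_dist_le[OF awalk_appendI[OF p(1) q(1)]] p(2) q(2) by simp
qed

lemma hop_dist_zero_iff:
  assumes "x \<in> verts G" "y \<in> verts G"
  shows "hop_dist x y = 0 \<longleftrightarrow> x = y"
proof
  assume "hop_dist x y = 0"
  then show "x = y" using hop_dist_walk[OF assms] by (metis awalk_Nil_iff length_0_conv)
next
  assume "x = y"
  then show "hop_dist x y = 0" using hop_dist_le[of x "[]" y] assms by (simp add: awalk_Nil_iff)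
qed

lemma hop_dist_one_iff:
  assumes "x \<in> verts G" "y \<in> verts G"
  shows "hop_dist x y = 1 \<longleftrightarrow> x \<rightarrow> y"
proof
  assume one: "hop_dist x y = 1"
  obtain p where p: "awalk x p y" "length p = hop_dist x y" using hop_dist_walk[OF assms] .
  then obtain e where "p = [e]" using one by (auto simp: length_Suc_conv)
  then show "x \<rightarrow> y" using p(1) by (auto simp: awalk_simps arcs_ends_conv)
next
  assume xy: "x \<rightarrow> y"
  then obtain e where "e \<in> arcs G" "tail G e = x" "head G e = y" by (rule reachableE)
  then have "awalk x [e] y" using assms by (simp add: awalk_simps)
  then have "hop_dist x y \<le> 1" using hop_dist_le[of x "[e]" y] by simp
  moreover have "hop_dist x y \<noteq> 0" using hop_dist_zero_iff[OF assms] adj_not_same[of x] xy by metis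
  ultimately show "hop_dist x y = 1" by linarith
qed

text \<open>Cutting a shortest walk provides both the first and the last step of a geodesic.\<close>
lemma hop_dist_step:
  assumes "x \<in> verts G" "y \<in> verts G" "hop_dist x y = i + j"
  shows "\<exists>z\<in>verts G. hop_dist x z = i \<and> hop_dist z y = j"
proof -
  obtain p where p: "awalk x p y" "length p = hop_dist x y" using hop_dist_walk assms(1,2) .
  define z where "z = awlast x (take i p)"
  have "awalk x (take i p @ drop i p) y" using p(1) by simp
  then have walks: "awalk x (take i p) z" "awalk z (drop i p) y"
    unfolding z_def awalk_append_iff by blast+
  then have z: "z \<in> verts G" using awalk_last_in_verts by blast
  have "hop_dist x z \<le> i" "hop_dist z y \<le> j"
    using hop_dist_le[OF walks(1)] hop_dist_le[OF walks(2)] p(2) assms(3) by simp_all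
  then have "hop_dist x z = i" "hop_dist z y = j"
    using hop_dist_triangle[OF assms(1) z assms(2)] assms(3) by linarith+
  then show ?thesis using z by blast
qed

text \<open>A walk of minimal length repeats no vertex, so paths and walks have the same distances.\<close>
lemma shortest_dipath_iff: "shortest_dipath G x p y \<longleftrightarrow> awalk x p y \<and> length p = hop_dist x y"
proof -
  have path: "apath x p y" if p: "awalk x p y" "length p = hop_dist x y" for p
  proof (rule ccontr)
    assume "\<not> apath x p y"
    then have "\<not> distinct (awalk_verts x p)" using p by (simp add: apath_def)
    then obtain q r s w where "p = q @ r @ s" "0 < length r" "awalk x q w" "awalk w s y"
      using awalk_not_distinct_decomp[OF p(1)] by blast
    then show False using hop_dist_le[OF awalk_appendI, of x q w s y] p(2) by (simp del: length_greater_0_conv)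
  qed
  show ?thesis
  proof
    assume s: "shortest_dipath G x p y"
    then have p: "awalk x p y" by (simp add: shortest_dipath_def apath_def)
    obtain q where q: "awalk x q y" "length q = hop_dist x y"
      using hop_dist_walk awalk_hd_in_verts[OF p] awalk_last_in_verts[OF p] .
    moreover have "length p \<le> length q" using path[OF q] s by (simp add: shortest_dipath_def)
    ultimately show "awalk x p y \<and> length p = hop_dist x y" using p hop_dist_le[OF p] by simp
  next
    assume "awalk x p y \<and> length p = hop_dist x y"
    then show "shortest_dipath G x p y"
      using path hop_dist_le by (auto simp: shortest_dipath_def apath_def)
  qed
qed

lemma interval_iff:
  assumes V: "x \<in> verts G" "y \<in> verts G" "z \<in> verts G"
  shows "z \<in> interval G x y \<longleftrightarrow> hop_dist x z + hop_dist z y = hop_dist x y"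
proof
  assume "z \<in> interval G x y"
  then obtain p where p: "awalk x p y" "length p = hop_dist x y" "z \<in> set (awalk_verts x p)"
    by (auto simp: interval_def shortest_dipath_iff)
  then obtain q r where qr: "p = q @ r" "awalk x q z" "awalk z r y" using awalk_decomp by blast
  then show "hop_dist x z + hop_dist z y = hop_dist x y"
    using hop_dist_le[OF qr(2)] hop_dist_le[OF qr(3)] hop_dist_triangle[OF V(1,3,2)] p(2) by simp
next
  assume eq: "hop_dist x z + hop_dist z y = hop_dist x y"
  obtain q where q: "awalk x q z" "length q = hop_dist x z" using hop_dist_walk V(1,3) .
  obtain r where r: "awalk z r y" "length r = hop_dist z y" using hop_dist_walk V(3,2) .
  have "z \<in> set (awalk_verts x (q @ r))"
    using q(1) r(1) by (simp add: set_awalk_verts_append hd_in_awalk_verts)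
  moreover have "shortest_dipath G x (q @ r) y"
    using awalk_appendI[OF q(1) r(1)] q(2) r(2) eq by (simp add: shortest_dipath_iff)
  ultimately show "z \<in> interval G x y" unfolding interval_def by blast
qed

sublocale tournament_distance "verts G" hop_dist
proof
  show "finite (verts G)" by (rule finite_verts)
next
  fix x y assume "x \<in> verts G" "y \<in> verts G"
  then show "hop_dist x y = 0 \<longleftrightarrow> x = y" by (rule hop_dist_zero_iff)
next
  fix x y z assume "x \<in> verts G" "y \<in> verts G" "z \<in> verts G"
  then show "hop_dist x z \<le> hop_dist x y + hop_dist y z" by (rule hop_dist_triangle)
next
  fix x y assume V: "x \<in> verts G" "y \<in> verts G" and "x \<noteq> y"
  then show "hop_dist x y = 1 \<longleftrightarrow> hop_dist y x \<noteq> 1"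
    using orientation[of x y] hop_dist_one_iff[OF V] hop_dist_one_iff[OF V(2,1)] by blast
next
  fix x y k assume V: "x \<in> verts G" "y \<in> verts G" and k: "hop_dist x y = Suc k"
  show "\<exists>z\<in>verts G. hop_dist x z = 1 \<and> hop_dist z y = k"
    using hop_dist_step[OF V, of 1 k] k by simp
  show "\<exists>z\<in>verts G. hop_dist x z = k \<and> hop_dist z y = 1"
    using hop_dist_step[OF V, of k 1] k by simp
qed

lemma line_eq_arc_line:
  assumes V: "x \<in> verts G" "y \<in> verts G" and xy: "hop_dist x y = 1"
  shows "line G x y = arc_line x y"
proof -
  have "w \<in> line G x y \<longleftrightarrow> w \<in> arc_line x y" if w: "w \<in> verts G" for w
  proof -
    have "w = x \<or> w = y" if "hop_dist x w + hop_dist w y = 1"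
    proof -
      have "hop_dist x w = 0 \<or> hop_dist w y = 0" using that by linarith
      then show ?thesis using hop_dist_zero_iff[OF V(1) w] hop_dist_zero_iff[OF w V(2)] by blast
    qed
    moreover have "x \<in> arc_line x y" "y \<in> arc_line x y"
      using V xy hop_dist_zero_iff[of x x] hop_dist_zero_iff[of y y] by (simp_all add: arc_line_def)
    ultimately show ?thesis
      using w xy interval_iff[OF w V(2,1)] interval_iff[OF V(1) w V(2)] interval_iff[OF V w]
      by (auto simp: line_def arc_line_def)
  qed
  moreover have "line G x y \<subseteq> verts G" "arc_line x y \<subseteq> verts G"
    by (auto simp: line_def arc_line_def)
  ultimately show ?thesis by blast
qed

lemma all_lines_subset: "all_lines \<subseteq> lines G"
proof
  fix l assume "l \<in> all_lines"
  then obtain x y where xy: "x \<in> verts G" "y \<in> verts G" "hop_dist x y = 1" "l = arc_line x y"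
    by (auto simp: all_lines_def)
  then have "x \<noteq> y" using hop_dist_zero_iff[of x y] by auto
  then show "l \<in> lines G" using xy line_eq_arc_line[OF xy(1-3)] by (auto simp: lines_def)
qed

lemma finite_lines: "finite (lines G)"
proof -
  have "lines G \<subseteq> Pow (verts G)" by (auto simp: lines_def line_def)
  then show ?thesis using finite_verts finite_subset by blast
qed

end

theorem theorem6:
  fixes D :: "('a, 'b) pre_digraph"
  assumes "tournament D"
    and "strongly_connected D"
    and "card (verts D) \<ge> 2"
  shows "card (lines D) \<ge> card (verts D) \<or> verts D \<in> lines D"
proof -
  interpret strong_tournament D
    using assms(1,2) by (simp add: strong_tournament_def strong_tournament_axioms_def)
  show ?thesis
  proof (cases "verts D \<in> all_lines")
    case True
    then show ?thesis using all_lines_subset by blast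
  next
    case False
    then have "card (verts D) \<le> card all_lines"
      using many_lines[OF assms(3)] by (auto simp: all_lines_def)
    also have "\<dots> \<le> card (lines D)" using card_mono[OF finite_lines all_lines_subset] .
    finally show ?thesis ..
  qed
qed

end
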